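(* Let $R$ be a finite commutative ring with unity, let $r\in R^\times$ and $a,b\in R$ with $a-b$ a unit of $R$, and let $f(t)=r\left(\frac{1-at}{1-bt}\right)\in R[[t]]$. Then: (1) $\mathcal{A}_f$ is reversible if and only if $b$ is a unit of $R$; (2) $(\mathcal{A}_f)^{-1}$ is reversible if and only if $a$ is a unit of $R$; (3) $\mathcal{A}_f$ is bireversible if and only if both $a$ and $b$ are units of $R$.
   Context: $R^\times$ is the group of units of $R$ and $R[[t]]$ the ring of formal power series over $R$; elements of $R$ are viewed as constant power series, and $\frac{1}{1-bt}=\sum_{n\ge 0}b^nt^n$. For $h\in R[[t]]$ define maps $R[[t]]\to R[[t]]$ by $\mu_h(g)=hg$ and $\alpha_h(g)=h+g$. Products of maps denote composition. A (Mealy) automaton is a 4-tuple $\mathcal{A}=(Q,X,\delta,\lambda)$ with state set $Q$, finite alphabet $X$, transition function $\delta:Q\times X\to Q$ and output function $\lambda:Q\times X\to X$. Write $\lambda_q(x)=\lambda(q,x)$ and $\delta_x(q)=\delta(q,x)$. It is drawn as a labeled directed graph with edges $q\xrightarrow{x\,\mid\,\lambda_q(x)}\delta(q,x)$. It is invertible if $\lambda_q$ is a permutation of $X$ for each $q\in Q$; then the inverse automaton $\mathcal{A}^{-1}$ is obtained by switching input and output letters on all edge labels, i.e. it has an edge $q\xrightarrow{\lambda_q(x)\,\mid\, x}\delta(q,x)$ for all $q,x$. The dual automaton is $\partial\mathcal{A}=(X,Q,\lambda,\delta)$ (states and alphabet interchanged, transition and output functions interchanged). An invertible automaton is reversible if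 its dual is invertible (equivalently, $\delta_x$ is a permutation of $Q$ for each $x\in X$), and bireversible if it is reversible and additionally its inverse is reversible. The automaton $\mathcal{A}_f$ has alphabet $R$, state set $Q=\{\alpha_{-sra}\mu_f\alpha_{sb}: s\in R\}$ (a set of permutations of $R[[t]]$), transition function $\delta(\alpha_{-sra}\mu_f\alpha_{sb},\tilde s)=\alpha_{-(sb+\tilde s)ra}\mu_f\alpha_{(sb+\tilde s)b}$ and output function $\lambda(\alpha_{-sra}\mu_f\alpha_{sb},\tilde s)=r(\tilde s+(b-a)s)$ for $s,\tilde s\in R$. These are well defined. *)

theory Defs
  imports "HOL-Computational_Algebra.Formal_Power_Series"
begin

text \<open>A Mealy automaton. The components \<open>trans_fun\<close> and \<open>output_fun\<close> are total functions, of
  which only the values on \<open>states A \<times> alphabet A\<close> matter.\<close>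

record ('q, 'x) automaton =
  states :: "'q set"
  alphabet :: "'x set"
  trans_fun :: "'q \<Rightarrow> 'x \<Rightarrow> 'q"
  output_fun :: "'q \<Rightarrow> 'x \<Rightarrow> 'x"

definition mealy_automaton :: "('q, 'x) automaton \<Rightarrow> bool" where
  "mealy_automaton A \<longleftrightarrow> finite (alphabet A) \<and>
     (\<forall>q \<in> states A. \<forall>x \<in> alphabet A. trans_fun A q x \<in> states A \<and> output_fun A q x \<in> alphabet A)"

definition invertible :: "('q, 'x) automaton \<Rightarrow> bool" where
  "invertible A \<longleftrightarrow> (\<forall>q \<in> states A. bij_betw (output_fun A q) (alphabet A) (alphabet A))"

text \<open>The edges of the inverse are \<open>q \<rightarrow> trans_fun A q x\<close> labelled \<open>output_fun A q x | x\<close>; so on input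
  \<open>y\<close> one first recovers the \<open>x\<close> with \<open>output_fun A q x = y\<close>. This is meaningful only for
  invertible \<open>A\<close>.\<close>

definition inverse_automaton :: "('q, 'x) automaton \<Rightarrow> ('q, 'x) automaton" where
  "inverse_automaton A =
     \<lparr>states = states A, alphabet = alphabet A,
      trans_fun = (\<lambda>q y. trans_fun A q (inv_into (alphabet A) (output_fun A q) y)),
      output_fun = (\<lambda>q y. inv_into (alphabet A) (output_fun A q) y)\<rparr>"

definition dual_automaton :: "('q, 'x) automaton \<Rightarrow> ('x, 'q) automaton" where
  "dual_automaton A =
     \<lparr>states = alphabet A, alphabet = states A,
      trans_fun = (\<lambda>x q. output_fun A q x), output_fun = (\<lambda>x q. trans_fun A q x)\<rparr>"

definition reversible :: "('q, 'x) automaton \<Rightarrow> bool" where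
  "reversible A \<longleftrightarrow> invertible A \<and> invertible (dual_automaton A)"

definition bireversible :: "('q, 'x) automaton \<Rightarrow> bool" where
  "bireversible A \<longleftrightarrow> reversible A \<and> reversible (inverse_automaton A)"

text \<open>Commutative rings with unity are rendered by the sort \<open>{comm_ring, comm_monoid_mult}\<close>
  rather than \<open>comm_ring_1\<close>, since the latter excludes the zero ring.\<close>

definition mu :: "'a::comm_ring fps \<Rightarrow> 'a fps \<Rightarrow> 'a fps" where
  "mu h g = h * g"

definition alpha :: "'a::comm_ring fps \<Rightarrow> 'a fps \<Rightarrow> 'a fps" where
  "alpha h g = h + g"

text \<open>The series \<open>r (1 - a t) / (1 - b t)\<close>, where \<open>1 / (1 - b t)\<close> is the geometric series.\<close>

definition series_f :: "'a::{comm_ring, comm_monoid_mult} \<Rightarrow> 'a \<Rightarrow> 'a \<Rightarrow> 'a fps" where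
  "series_f r a b = fps_const r * ((1 - fps_const a * fps_X) * Abs_fps (\<lambda>n. b ^ n))"

definition state :: "'a::{comm_ring, comm_monoid_mult} \<Rightarrow> 'a \<Rightarrow> 'a \<Rightarrow> 'a \<Rightarrow> 'a fps \<Rightarrow> 'a fps" where
  "state r a b s =
     alpha (fps_const (- (s * r * a))) \<circ> mu (series_f r a b) \<circ> alpha (fps_const (s * b))"

text \<open>The states are maps on power series, not parameters \<open>s\<close>. Transition and output are
  specified through any parameter representing the state; \<open>trans_automaton_f\<close> and
  \<open>output_automaton_f\<close> below show that this is well defined.\<close>

definition automaton_f ::
  "'a::{comm_ring, comm_monoid_mult} \<Rightarrow> 'a \<Rightarrow> 'a \<Rightarrow> ('a fps \<Rightarrow> 'a fps, 'a) automaton" where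
  "automaton_f r a b =
     \<lparr>states = range (state r a b), alphabet = UNIV,
      trans_fun = (\<lambda>q x. THE q'. \<exists>s. q = state r a b s \<and> q' = state r a b (s * b + x)),
      output_fun = (\<lambda>q x. THE y. \<exists>s. q = state r a b s \<and> y = r * (x + (b - a) * s))\<rparr>"

lemma state_inject:
  fixes r a b :: "'a::{comm_ring, comm_monoid_mult}"
  assumes "r dvd 1" and "(a - b) dvd 1"
  shows "state r a b s = state r a b s' \<longleftrightarrow> s = s'"
proof
  assume "state r a b s = state r a b s'"
  then have "fps_nth (state r a b s 0) 0 = fps_nth (state r a b s' 0) 0"
    by simp
  then have eq: "s * (r * (a - b)) = s' * (r * (a - b))"
    by (simp add: state_def alpha_def mu_def series_f_def algebra_simps)
  obtain u v where u: "r * u = 1" and v: "(a - b) * v = 1"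
    using assms by (metis dvdE)
  have *: "x * (r * (a - b)) * (u * v) = x" for x
  proof -
    have "x * (r * (a - b)) * (u * v) = x * ((r * u) * ((a - b) * v))"
      by (simp only: ac_simps)
    then show ?thesis
      by (simp add: u v)
  qed
  show "s = s'"
    using eq * by metis
qed simp

lemma trans_automaton_f:
  fixes r a b :: "'a::{comm_ring, comm_monoid_mult}"
  assumes "r dvd 1" and "(a - b) dvd 1"
  shows "trans_fun (automaton_f r a b) (state r a b s) x = state r a b (s * b + x)"
  by (simp add: automaton_f_def state_inject[OF assms])

lemma output_automaton_f:
  fixes r a b :: "'a::{comm_ring, comm_monoid_mult}"
  assumes "r dvd 1" and "(a - b) dvd 1"
  shows "output_fun (automaton_f r a b) (state r a b s) x = r * (x + (b - a) * s)"
  by (simp add: automaton_f_def state_inject[OF assms])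

lemma mealy_automaton_f:
  fixes r a b :: "'a::{comm_ring, comm_monoid_mult, finite}"
  assumes "r dvd 1" and "(a - b) dvd 1"
  shows "mealy_automaton (automaton_f r a b)"
proof -
  have "trans_fun (automaton_f r a b) q x \<in> states (automaton_f r a b)"
    if "q \<in> states (automaton_f r a b)" for q x
  proof -
    obtain s where "q = state r a b s"
      using \<open>q \<in> _\<close> by (auto simp: automaton_f_def)
    then show ?thesis
      by (simp add: trans_automaton_f[OF assms]) (simp add: automaton_f_def)
  qed
  then show ?thesis
    by (auto simp: mealy_automaton_def) (simp_all add: automaton_f_def)
qed

end

theory Submission
  imports Defs
begin

text \<open>Identify a state with its parameter \<open>s\<close>, which is legitimate by \<open>state_inject\<close>. Each
  letter \<open>x\<close> then acts on states by the affine map \<open>s \<mapsto> s b + x\<close>, and an affine map of a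
  commutative ring is bijective exactly when its slope is a unit. Hence the dual of the automaton
  is invertible iff \<open>b\<close> is a unit. The output map \<open>x \<mapsto> r (x + (b - a) s)\<close> is always a
  permutation, because \<open>r\<close> is a unit.

  In the inverse automaton, let \<open>u\<close> be the inverse of \<open>r\<close>. In state \<open>s\<close> the letter \<open>y\<close> is
  produced by \<open>x = u y - (b - a) s\<close>, so the transition goes to \<open>s b + x = s a + u y\<close>: the slope
  changes from \<open>b\<close> to \<open>a\<close>. The same criterion (\<open>invertible_dual_iff_slope_unit\<close>) therefore
  settles both reversibility questions, and bireversibility is their conjunction.\<close>

lemma bij_affine_iff_unit:
  fixes c d :: "'a::{comm_ring, comm_monoid_mult}"
  shows "bij (\<lambda>s. s * c + d) \<longleftrightarrow> c dvd 1"
proof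
  assume "bij (\<lambda>s. s * c + d)"
  then have "surj (\<lambda>s. s * c + d)"
    by (rule bij_is_surj)
  then obtain s where "1 + d = s * c + d"
    by (rule surjE)
  then have "1 = c * s"
    by (simp add: mult.commute)
  then show "c dvd 1" ..
next
  assume "c dvd 1"
  then obtain v where v: "1 = c * v" ..
  have "x * c * v = x" for x
    by (simp add: mult.assoc flip: v)
  moreover have "x * v * c = x" for x
    by (simp add: mult.assoc mult.commute[of v c] flip: v)
  ultimately have cancel: "x * c * v = x" "x * v * c = x" for x
    by blast+
  show "bij (\<lambda>s. s * c + d)"
    by (rule o_bij[of "\<lambda>y. (y - d) * v"]) (simp_all add: fun_eq_iff cancel)
qed

lemma bij_betw_range_conjugate:
  assumes "inj \<sigma>" and "\<And>s. g (\<sigma> s) = \<sigma> (h s)"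
  shows "bij_betw g (range \<sigma>) (range \<sigma>) \<longleftrightarrow> bij h"
proof -
  have \<sigma>: "bij_betw \<sigma> UNIV (range \<sigma>)"
    using assms(1) by (simp add: bij_betw_def)
  have "bij_betw g (range \<sigma>) (range \<sigma>) \<longleftrightarrow> bij_betw (g \<circ> \<sigma>) UNIV (range \<sigma>)"
    by (rule bij_betw_comp_iff[OF \<sigma>])
  also have "g \<circ> \<sigma> = \<sigma> \<circ> h"
    by (simp add: fun_eq_iff assms(2))
  also have "bij_betw (\<sigma> \<circ> h) UNIV (range \<sigma>) \<longleftrightarrow> bij h"
    using bij_betw_comp_iff2[OF \<sigma>, of h UNIV] by simp
  finally show ?thesis .
qed

text \<open>The translation part \<open>k x\<close> depends on the letter in an arbitrary way, so that the criterion
  covers the automaton and its inverse alike.\<close>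

lemma invertible_dual_iff_slope_unit:
  fixes c :: "'a::{comm_ring, comm_monoid_mult}"
  assumes "states A = range \<sigma>" and "alphabet A \<noteq> {}" and "inj \<sigma>"
    and "\<And>s x. x \<in> alphabet A \<Longrightarrow> trans_fun A (\<sigma> s) x = \<sigma> (s * c + k x)"
  shows "invertible (dual_automaton A) \<longleftrightarrow> c dvd 1"
proof -
  have "bij_betw (\<lambda>q. trans_fun A q x) (range \<sigma>) (range \<sigma>) \<longleftrightarrow> c dvd 1"
    if "x \<in> alphabet A" for x
    using bij_betw_range_conjugate[OF assms(3), of "\<lambda>q. trans_fun A q x" "\<lambda>s. s * c + k x"]
      assms(4)[OF that] by (simp add: bij_affine_iff_unit)
  then show ?thesis
    using assms(1,2) by (auto simp: invertible_def dual_automaton_def)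
qed

lemma invertible_inverse_automaton:
  "invertible A \<Longrightarrow> invertible (inverse_automaton A)"
  by (simp add: invertible_def inverse_automaton_def bij_betw_inv_into)

lemma states_automaton_f: "states (automaton_f r a b) = range (state r a b)"
  and alphabet_automaton_f: "alphabet (automaton_f r a b) = UNIV"
  by (simp_all add: automaton_f_def)

lemma invertible_automaton_f:
  fixes r a b :: "'a::{comm_ring, comm_monoid_mult}"
  assumes "r dvd 1" and "(a - b) dvd 1"
  shows "invertible (automaton_f r a b)"
proof -
  have "bij (output_fun (automaton_f r a b) (state r a b s))" for s
  proof -
    have "output_fun (automaton_f r a b) (state r a b s) = (\<lambda>x. x * r + r * ((b - a) * s))"
      by (rule ext) (simp only: output_automaton_f[OF assms] distrib_left mult.commute[of r])
    then show ?thesis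
      using assms(1) by (simp add: bij_affine_iff_unit)
  qed
  then show ?thesis
    by (auto simp: invertible_def states_automaton_f alphabet_automaton_f)
qed

lemma trans_inverse_automaton_f:
  fixes r a b u :: "'a::{comm_ring, comm_monoid_mult}"
  assumes "r dvd 1" and "(a - b) dvd 1" and "r * u = 1"
  shows "trans_fun (inverse_automaton (automaton_f r a b)) (state r a b s) y
    = state r a b (s * a + u * y)"
proof -
  let ?out = "output_fun (automaton_f r a b) (state r a b s)"
  have "inj ?out"
    using invertible_automaton_f[OF assms(1,2)]
    by (auto simp: invertible_def states_automaton_f alphabet_automaton_f bij_is_inj)
  moreover have "?out (u * y - (b - a) * s) = y"
    using assms(3) by (simp add: output_automaton_f[OF assms(1,2)] flip: mult.assoc)
  ultimately have "inv ?out y = u * y - (b - a) * s"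
    by (rule inv_f_eq)
  then show ?thesis
    by (simp add: inverse_automaton_def alphabet_automaton_f trans_automaton_f[OF assms(1,2)]
        algebra_simps)
qed

theorem theorem3p9:
  fixes r a b :: "'a::{comm_ring, comm_monoid_mult, finite}"
  assumes "r dvd 1" and "(a - b) dvd 1"
  shows "(reversible (automaton_f r a b) \<longleftrightarrow> b dvd 1) \<and>
         (reversible (inverse_automaton (automaton_f r a b)) \<longleftrightarrow> a dvd 1) \<and>
         (bireversible (automaton_f r a b) \<longleftrightarrow> a dvd 1 \<and> b dvd 1)"
proof -
  let ?A = "automaton_f r a b"
  have inj: "inj (state r a b)"
    by (simp add: inj_def state_inject[OF assms])
  obtain u where u: "r * u = 1"
    using assms(1) by (auto simp: dvd_def)
  have "invertible (dual_automaton ?A) \<longleftrightarrow> b dvd 1"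
    by (rule invertible_dual_iff_slope_unit[where k = "\<lambda>x. x", OF _ _ inj])
      (simp_all add: states_automaton_f alphabet_automaton_f trans_automaton_f[OF assms])
  then have rev: "reversible ?A \<longleftrightarrow> b dvd 1"
    by (simp add: reversible_def invertible_automaton_f[OF assms])
  have "states (inverse_automaton ?A) = range (state r a b)"
    and "alphabet (inverse_automaton ?A) \<noteq> {}"
    by (simp_all add: inverse_automaton_def states_automaton_f alphabet_automaton_f)
  then have "invertible (dual_automaton (inverse_automaton ?A)) \<longleftrightarrow> a dvd 1"
    by (rule invertible_dual_iff_slope_unit[where k = "\<lambda>y. u * y", OF _ _ inj])
      (rule trans_inverse_automaton_f[OF assms u])
  then have rev_inv: "reversible (inverse_automaton ?A) \<longleftrightarrow> a dvd 1"
    by (simp add: reversible_def invertible_inverse_automaton invertible_automaton_f[OF assms])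
  show ?thesis
    using rev rev_inv by (auto simp: bireversible_def)
qed

end
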